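(* Let $\mathfrak{g}$ be an $n$-dimensional Lie algebra over $\mathbb{K}$ ($\mathbb{K}=\mathbb{R}$ or $\mathbb{C}$) with ordered basis $X_1,\dots,X_n$ and structure constants $C_{\mu\nu\alpha}$, $[X_\mu,X_\nu]=\sum_{\alpha=1}^n C_{\mu\nu\alpha}X_\alpha$. Let $\mathfrak{g}^L\supset \mathfrak{g}$ and the left action $\blacktriangleright$ of $U(\mathfrak{g}^L)$ on $U(\mathfrak{g})$ be as described in the context. Let $X$ be a monomial in $U(\mathfrak{g})\subset U(\mathfrak{g}^L)$ (a product of basis elements $X_1,\dots,X_n$). If $X_\mu$ is shifted to the far right in the product $X_\mu X$, then in $U(\mathfrak{g})$ $$X_\mu X=\sum_{\alpha=1}^n (T_{\mu\alpha}\blacktriangleright X)\,X_\alpha,\qquad 1\le\mu\le n.$$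
   Context: $U(\cdot)$ denotes the universal enveloping algebra; $U(\mathfrak{g})\subset U(\mathfrak{g}^L)$. $\mathfrak{g}^L$ is the Lie algebra over $\mathbb{K}$ with basis $\{X_\mu, T_{\mu\nu}\mid 1\le\mu,\nu\le n\}$ and brackets $$[X_\mu,X_\nu]=\sum_{\alpha=1}^n C_{\mu\nu\alpha}X_\alpha,\qquad [T_{\mu\nu},T_{\alpha\beta}]=0,\qquad [T_{\mu\nu},X_\lambda]=\sum_{\alpha=1}^n C_{\mu\lambda\alpha}T_{\alpha\nu}.$$ The left action $\blacktriangleright\colon U(\mathfrak{g}^L)\otimes U(\mathfrak{g})\to U(\mathfrak{g})$ is the linear map determined by $1\blacktriangleright X=X$, $X_\mu\blacktriangleright X=X_\mu X$, $T_{\mu\nu}\blacktriangleright 1=\delta_{\mu\nu}$ and $(ab)\blacktriangleright X=a\blacktriangleright(b\blacktriangleright X)$ for $X\in U(\mathfrak{g})$, $a,b\in U(\mathfrak{g}^L)$. *)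

theory Defs
  imports Complex_Main "HOL-Library.Poly_Mapping" "HOL-Algebra.QuotRing"
begin

section \<open>Lie algebras and bases\<close>

definition (in vector_space) basis_family :: "'i set \<Rightarrow> ('i \<Rightarrow> 'b) \<Rightarrow> bool" where
  "basis_family I e \<longleftrightarrow> inj_on e I \<and> independent (e ` I) \<and> span (e ` I) = UNIV"

locale lie_algebra = vector_space scale
  for scale :: "'k::field \<Rightarrow> 'a::ab_group_add \<Rightarrow> 'a" +
  fixes bracket :: "'a \<Rightarrow> 'a \<Rightarrow> 'a"
  assumes bracket_add_left: "bracket (x + y) z = bracket x z + bracket y z"
    and bracket_add_right: "bracket x (y + z) = bracket x y + bracket x z"
    and bracket_scale_left: "bracket (scale c x) y = scale c (bracket x y)"
    and bracket_scale_right: "bracket x (scale c y) = scale c (bracket x y)"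
    and bracket_self: "bracket x x = 0"
    and jacobi: "bracket x (bracket y z) + bracket y (bracket z x) + bracket z (bracket x y) = 0"

locale based_lie_algebra = lie_algebra scale bracket
  for scale :: "'k::field \<Rightarrow> 'a::ab_group_add \<Rightarrow> 'a" and bracket +
  fixes n :: nat and X :: "nat \<Rightarrow> 'a" and C :: "nat \<Rightarrow> nat \<Rightarrow> nat \<Rightarrow> 'k"
  assumes basis: "basis_family {1..n} X"
    and structure_constants:
      "\<lbrakk>\<mu> \<in> {1..n}; \<nu> \<in> {1..n}\<rbrakk> \<Longrightarrow> bracket (X \<mu>) (X \<nu>) = (\<Sum>\<alpha>=1..n. scale (C \<mu> \<nu> \<alpha>) (X \<alpha>))"

text \<open>
  The Lie algebra \<open>\<gg>\<^sup>L\<close>, as a Lie algebra on a type of its own. The inclusion of \<open>\<gg>\<close> is the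
  map \<open>emb\<close>, so that \<open>emb (X \<mu>)\<close> is the element called \<open>X\<^sub>\<mu>\<close> of \<open>\<gg>\<^sup>L\<close>; \<open>emb\<close> is injective because
  it maps a basis to part of a basis.
\<close>

locale extended_lie_algebra =
  g: based_lie_algebra scale bracket n X C + gL: lie_algebra scaleL bracketL
  for scale :: "'k::field \<Rightarrow> 'a::ab_group_add \<Rightarrow> 'a" and bracket n X C
    and scaleL :: "'k \<Rightarrow> 'b::ab_group_add \<Rightarrow> 'b" and bracketL +
  fixes emb :: "'a \<Rightarrow> 'b" and T :: "nat \<Rightarrow> nat \<Rightarrow> 'b"
  assumes emb_linear: "Vector_Spaces.linear scale scaleL emb"
    and emb_bracket: "emb (bracket x y) = bracketL (emb x) (emb y)"
    and basisL: "gL.basis_family ({1..n} <+> {1..n} \<times> {1..n})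
                   (case_sum (\<lambda>\<mu>. emb (X \<mu>)) (\<lambda>(\<mu>, \<nu>). T \<mu> \<nu>))"
    and bracket_X_X: "\<lbrakk>\<mu> \<in> {1..n}; \<nu> \<in> {1..n}\<rbrakk> \<Longrightarrow>
          bracketL (emb (X \<mu>)) (emb (X \<nu>)) = (\<Sum>\<alpha>=1..n. scaleL (C \<mu> \<nu> \<alpha>) (emb (X \<alpha>)))"
    and bracket_T_T: "\<lbrakk>\<mu> \<in> {1..n}; \<nu> \<in> {1..n}; \<alpha> \<in> {1..n}; \<beta> \<in> {1..n}\<rbrakk> \<Longrightarrow>
          bracketL (T \<mu> \<nu>) (T \<alpha> \<beta>) = 0"
    and bracket_T_X: "\<lbrakk>\<mu> \<in> {1..n}; \<nu> \<in> {1..n}; \<kappa> \<in> {1..n}\<rbrakk> \<Longrightarrow>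
          bracketL (T \<mu> \<nu>) (emb (X \<kappa>)) = (\<Sum>\<alpha>=1..n. scaleL (C \<mu> \<kappa> \<alpha>) (T \<alpha> \<nu>))"


section \<open>Free associative algebras\<close>

text \<open>
  Words form the free monoid, written additively because the convolution product of
  \<^theory>\<open>HOL-Library.Poly_Mapping\<close> expects an additive monoid of exponents. It makes
  \<open>'a free_monoid \<Rightarrow>\<^sub>0 'k\<close> the free associative unital \<open>'k\<close>-algebra on \<open>'a\<close>.
\<close>

datatype 'a free_monoid = Word (letters: "'a list")

instantiation free_monoid :: (type) monoid_add
begin

definition zero_free_monoid :: "'a free_monoid" where
  "0 = Word []"

definition plus_free_monoid :: "'a free_monoid \<Rightarrow> 'a free_monoid \<Rightarrow> 'a free_monoid" where
  "v + w = Word (letters v @ letters w)"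

instance
  by standard (auto simp: zero_free_monoid_def plus_free_monoid_def)

end

definition free_algebra :: "('a free_monoid \<Rightarrow>\<^sub>0 'k::comm_ring_1) ring" where
  "free_algebra = \<lparr>carrier = UNIV, monoid.mult = (*), one = 1, zero = 0, add = (+)\<rparr>"

definition free_const :: "'k::comm_ring_1 \<Rightarrow> 'a free_monoid \<Rightarrow>\<^sub>0 'k" where
  "free_const c = Poly_Mapping.single 0 c"

definition free_gen :: "'a \<Rightarrow> 'a free_monoid \<Rightarrow>\<^sub>0 'k::comm_ring_1" where
  "free_gen x = Poly_Mapping.single (Word [x]) 1"

lemma ring_free_algebra: "ring (free_algebra :: ('a free_monoid \<Rightarrow>\<^sub>0 'k::comm_ring_1) ring)"
proof (rule ringI)
  show "abelian_group (free_algebra :: ('a free_monoid \<Rightarrow>\<^sub>0 'k) ring)"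
    by (rule abelian_groupI)
      (auto simp: free_algebra_def algebra_simps intro: exI[of _ "- x" for x])
  show "Group.monoid (free_algebra :: ('a free_monoid \<Rightarrow>\<^sub>0 'k) ring)"
    by (rule Group.monoidI) (auto simp: free_algebra_def algebra_simps)
qed (auto simp: free_algebra_def algebra_simps)


section \<open>Universal enveloping algebras\<close>

text \<open>
  The first two families of relations make \<open>free_gen\<close> linear, so they cut the free algebra on the
  underlying set of the Lie algebra down to the tensor algebra of the underlying vector space.
\<close>

definition uea_relations ::
  "('k::field \<Rightarrow> 'a::ab_group_add \<Rightarrow> 'a) \<Rightarrow> ('a \<Rightarrow> 'a \<Rightarrow> 'a) \<Rightarrow> ('a free_monoid \<Rightarrow>\<^sub>0 'k) set" where
  "uea_relations scale bracket =
     {free_gen (x + y) - (free_gen x + free_gen y) | x y. True} \<union>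
     {free_gen (scale c x) - free_const c * free_gen x | c x. True} \<union>
     {free_gen x * free_gen y - free_gen y * free_gen x - free_gen (bracket x y) | x y. True}"

definition uea_ideal ::
  "('k::field \<Rightarrow> 'a::ab_group_add \<Rightarrow> 'a) \<Rightarrow> ('a \<Rightarrow> 'a \<Rightarrow> 'a) \<Rightarrow> ('a free_monoid \<Rightarrow>\<^sub>0 'k) set" where
  "uea_ideal scale bracket = genideal free_algebra (uea_relations scale bracket)"

definition uea ::
  "('k::field \<Rightarrow> 'a::ab_group_add \<Rightarrow> 'a) \<Rightarrow> ('a \<Rightarrow> 'a \<Rightarrow> 'a) \<Rightarrow> ('a free_monoid \<Rightarrow>\<^sub>0 'k) set ring" where
  "uea scale bracket = free_algebra Quot uea_ideal scale bracket"

definition uea_gen ::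
  "('k::field \<Rightarrow> 'a::ab_group_add \<Rightarrow> 'a) \<Rightarrow> ('a \<Rightarrow> 'a \<Rightarrow> 'a) \<Rightarrow> 'a \<Rightarrow> ('a free_monoid \<Rightarrow>\<^sub>0 'k) set" where
  "uea_gen scale bracket x = uea_ideal scale bracket +>\<^bsub>free_algebra\<^esub> free_gen x"

definition uea_scale ::
  "('k::field \<Rightarrow> 'a::ab_group_add \<Rightarrow> 'a) \<Rightarrow> ('a \<Rightarrow> 'a \<Rightarrow> 'a) \<Rightarrow>
     'k \<Rightarrow> ('a free_monoid \<Rightarrow>\<^sub>0 'k) set \<Rightarrow> ('a free_monoid \<Rightarrow>\<^sub>0 'k) set" where
  "uea_scale scale bracket c u =
     (uea_ideal scale bracket +>\<^bsub>free_algebra\<^esub> free_const c) \<otimes>\<^bsub>uea scale bracket\<^esub> u"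

definition uea_monomial ::
  "('k::field \<Rightarrow> 'a::ab_group_add \<Rightarrow> 'a) \<Rightarrow> ('a \<Rightarrow> 'a \<Rightarrow> 'a) \<Rightarrow> 'a list \<Rightarrow> ('a free_monoid \<Rightarrow>\<^sub>0 'k) set" where
  "uea_monomial scale bracket xs =
     foldr (\<lambda>x u. uea_gen scale bracket x \<otimes>\<^bsub>uea scale bracket\<^esub> u) xs \<one>\<^bsub>uea scale bracket\<^esub>"

lemma ring_uea: "ring (uea scale bracket)"
  unfolding uea_def uea_ideal_def
  by (intro ideal.quotient_is_ring ring.genideal_ideal ring_free_algebra)
    (simp add: free_algebra_def)


section \<open>The left action\<close>

text \<open>
  A linear map on \<open>U(\<gg>\<^sup>L) \<otimes> U(\<gg>)\<close> is given as a bilinear map on \<open>U(\<gg>\<^sup>L) \<times> U(\<gg>)\<close>. Nothing is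
  assumed about \<open>act\<close> outside the carriers.
\<close>

locale left_action = extended_lie_algebra scale bracket n X C scaleL bracketL emb T
  for scale :: "'k::field \<Rightarrow> 'a::ab_group_add \<Rightarrow> 'a" and bracket n X C
    and scaleL :: "'k \<Rightarrow> 'b::ab_group_add \<Rightarrow> 'b" and bracketL emb T +
  fixes act :: "('b free_monoid \<Rightarrow>\<^sub>0 'k) set \<Rightarrow> ('a free_monoid \<Rightarrow>\<^sub>0 'k) set \<Rightarrow> ('a free_monoid \<Rightarrow>\<^sub>0 'k) set"
  assumes act_closed: "\<lbrakk>a \<in> carrier (uea scaleL bracketL); x \<in> carrier (uea scale bracket)\<rbrakk> \<Longrightarrow>
          act a x \<in> carrier (uea scale bracket)"
    and act_add_left: "\<lbrakk>a \<in> carrier (uea scaleL bracketL); b \<in> carrier (uea scaleL bracketL);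
            x \<in> carrier (uea scale bracket)\<rbrakk> \<Longrightarrow>
          act (a \<oplus>\<^bsub>uea scaleL bracketL\<^esub> b) x = act a x \<oplus>\<^bsub>uea scale bracket\<^esub> act b x"
    and act_add_right: "\<lbrakk>a \<in> carrier (uea scaleL bracketL); x \<in> carrier (uea scale bracket);
            y \<in> carrier (uea scale bracket)\<rbrakk> \<Longrightarrow>
          act a (x \<oplus>\<^bsub>uea scale bracket\<^esub> y) = act a x \<oplus>\<^bsub>uea scale bracket\<^esub> act a y"
    and act_scale_left: "\<lbrakk>a \<in> carrier (uea scaleL bracketL); x \<in> carrier (uea scale bracket)\<rbrakk> \<Longrightarrow>
          act (uea_scale scaleL bracketL c a) x = uea_scale scale bracket c (act a x)"
    and act_scale_right: "\<lbrakk>a \<in> carrier (uea scaleL bracketL); x \<in> carrier (uea scale bracket)\<rbrakk> \<Longrightarrow>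
          act a (uea_scale scale bracket c x) = uea_scale scale bracket c (act a x)"
    and act_one: "x \<in> carrier (uea scale bracket) \<Longrightarrow> act \<one>\<^bsub>uea scaleL bracketL\<^esub> x = x"
    and act_X: "\<lbrakk>\<mu> \<in> {1..n}; x \<in> carrier (uea scale bracket)\<rbrakk> \<Longrightarrow>
          act (uea_gen scaleL bracketL (emb (X \<mu>))) x
            = uea_gen scale bracket (X \<mu>) \<otimes>\<^bsub>uea scale bracket\<^esub> x"
    and act_T_one: "\<lbrakk>\<mu> \<in> {1..n}; \<nu> \<in> {1..n}\<rbrakk> \<Longrightarrow>
          act (uea_gen scaleL bracketL (T \<mu> \<nu>)) \<one>\<^bsub>uea scale bracket\<^esub>
            = (if \<mu> = \<nu> then \<one>\<^bsub>uea scale bracket\<^esub> else \<zero>\<^bsub>uea scale bracket\<^esub>)"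
    and act_mult: "\<lbrakk>a \<in> carrier (uea scaleL bracketL); b \<in> carrier (uea scaleL bracketL);
            x \<in> carrier (uea scale bracket)\<rbrakk> \<Longrightarrow>
          act (a \<otimes>\<^bsub>uea scaleL bracketL\<^esub> b) x = act a (act b x)"

end

theory Submission
  imports Defs
begin

text \<open>
  Induction on the monomial. For \<open>X\<^sub>\<kappa> w\<close>, moving \<open>T\<^sub>\<mu>\<^sub>\<alpha>\<close> past \<open>X\<^sub>\<kappa>\<close> in \<open>U(\<gg>\<^sup>L)\<close> gives
  \<open>T\<^sub>\<mu>\<^sub>\<alpha> \<triangleright> (X\<^sub>\<kappa> w) = X\<^sub>\<kappa> (T\<^sub>\<mu>\<^sub>\<alpha> \<triangleright> w) + \<Sum>\<^sub>\<beta> C\<^sub>\<mu>\<^sub>\<kappa>\<^sub>\<beta> (T\<^sub>\<beta>\<^sub>\<alpha> \<triangleright> w)\<close>. Multiplying by \<open>X\<^sub>\<alpha>\<close> on the right,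
  summing over \<open>\<alpha>\<close> and using the induction hypothesis for \<open>\<mu>\<close> and for every \<open>\<beta>\<close> leaves
  \<open>X\<^sub>\<kappa> X\<^sub>\<mu> w + [X\<^sub>\<mu>, X\<^sub>\<kappa>] w = X\<^sub>\<mu> X\<^sub>\<kappa> w\<close>.
\<close>

text \<open>Cancellation in \<open>f 0 + f 0 = f 0\<close> makes \<open>f\<close> preserve zero, and
  induction on the index set does the rest. Additivity is asked for on the carrier alone, which is
  what the axioms of \<open>act\<close> provide for the map
  \<open>\<lambda>a. act a w\<close>.\<close>

lemma additive_finsum:
  assumes "abelian_group G" "abelian_group H"
    and closed: "\<And>x. x \<in> carrier G \<Longrightarrow> f x \<in> carrier H"
    and add: "\<And>x y. x \<in> carrier G \<Longrightarrow> y \<in> carrier G \<Longrightarrow> f (x \<oplus>\<^bsub>G\<^esub> y) = f x \<oplus>\<^bsub>H\<^esub> f y"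
    and "finite I" and g: "g \<in> I \<rightarrow> carrier G"
  shows "f (finsum G g I) = (\<Oplus>\<^bsub>H\<^esub>i\<in>I. f (g i))"
proof -
  interpret G: abelian_group G by fact
  interpret H: abelian_group H by fact
  have "f \<zero>\<^bsub>G\<^esub> \<oplus>\<^bsub>H\<^esub> f \<zero>\<^bsub>G\<^esub> = f \<zero>\<^bsub>G\<^esub>"
    by (simp flip: add)
  then have zero: "f \<zero>\<^bsub>G\<^esub> = \<zero>\<^bsub>H\<^esub>"
    by (simp add: closed)
  show ?thesis
    using \<open>finite I\<close> g
    by induction (simp_all add: zero add closed Pi_def)
qed

lemma (in abelian_monoid) finsum_swap:
  assumes "finite I" "finite J" "\<And>i j. i \<in> I \<Longrightarrow> j \<in> J \<Longrightarrow> f i j \<in> carrier G"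
  shows "(\<Oplus>i\<in>I. \<Oplus>j\<in>J. f i j) = (\<Oplus>j\<in>J. \<Oplus>i\<in>I. f i j)"
  using assms(1,3)
proof (induction I)
  case (insert i I)
  then have "(\<Oplus>j\<in>J. \<Oplus>i\<in>insert i I. f i j) = (\<Oplus>j\<in>J. f i j \<oplus> (\<Oplus>i\<in>I. f i j))"
    by (intro finsum_cong') auto
  with insert show ?case
    by (simp add: finsum_addf Pi_def)
qed simp

text \<open>The quotient map from the free algebra. Both the generators and the scalars in
  \<open>uea_scale\<close> are images under it, so identities between them can be checked in the
  free algebra modulo the relations.\<close>

abbreviation uea_proj ::
  "('k::field \<Rightarrow> 'a::ab_group_add \<Rightarrow> 'a) \<Rightarrow> ('a \<Rightarrow> 'a \<Rightarrow> 'a) \<Rightarrow>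
     ('a free_monoid \<Rightarrow>\<^sub>0 'k) \<Rightarrow> ('a free_monoid \<Rightarrow>\<^sub>0 'k) set" where
  "uea_proj scale bracket p \<equiv> uea_ideal scale bracket +>\<^bsub>free_algebra\<^esub> p"

lemma ideal_uea_ideal: "ideal (uea_ideal scale bracket) free_algebra"
  unfolding uea_ideal_def
  by (rule ring.genideal_ideal[OF ring_free_algebra]) (simp add: free_algebra_def)

lemma ring_hom_uea_proj: "uea_proj scale bracket \<in> ring_hom free_algebra (uea scale bracket)"
  unfolding uea_def by (rule ideal.rcos_ring_hom[OF ideal_uea_ideal])

lemma uea_proj_closed: "uea_proj scale bracket p \<in> carrier (uea scale bracket)"
  using ring_hom_closed[OF ring_hom_uea_proj] by (simp add: free_algebra_def)

lemma uea_proj_add: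
  "uea_proj scale bracket (p + q)
     = uea_proj scale bracket p \<oplus>\<^bsub>uea scale bracket\<^esub> uea_proj scale bracket q"
  using ring_hom_add[OF ring_hom_uea_proj, of p q] by (simp add: free_algebra_def)

lemma uea_proj_mult:
  "uea_proj scale bracket (p * q)
     = uea_proj scale bracket p \<otimes>\<^bsub>uea scale bracket\<^esub> uea_proj scale bracket q"
  using ring_hom_mult[OF ring_hom_uea_proj, of p q] by (simp add: free_algebra_def)

text \<open>A relation lies in the ideal, so its class vanishes, and \<open>p\<close> is
  \<open>(p - q) + q\<close>. This turns each of the three families of relations into an equation in
  the quotient.\<close>

lemma uea_proj_eqI:
  assumes "p - q \<in> uea_relations scale bracket"
  shows "uea_proj scale bracket p = uea_proj scale bracket q"
proof -
  interpret ideal "uea_ideal scale bracket" free_algebra by (rule ideal_uea_ideal)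
  have "p - q \<in> uea_ideal scale bracket"
    using assms ring.genideal_self[OF ring_free_algebra, of "uea_relations scale bracket"]
    by (auto simp: uea_ideal_def free_algebra_def)
  then have "uea_proj scale bracket (p - q) = \<zero>\<^bsub>uea scale bracket\<^esub>"
    using a_rcos_const by (simp add: uea_def FactRing_def)
  moreover have "uea_proj scale bracket p
      = uea_proj scale bracket (p - q) \<oplus>\<^bsub>uea scale bracket\<^esub> uea_proj scale bracket q"
    by (simp flip: uea_proj_add)
  ultimately show ?thesis
    using ring.ring_simprules(8)[OF ring_uea uea_proj_closed] by simp
qed

lemma uea_gen_closed: "uea_gen scale bracket x \<in> carrier (uea scale bracket)"
  unfolding uea_gen_def by (rule uea_proj_closed)

lemma uea_gen_add:
  "uea_gen scale bracket (x + y)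
     = uea_gen scale bracket x \<oplus>\<^bsub>uea scale bracket\<^esub> uea_gen scale bracket y"
  unfolding uea_gen_def uea_proj_add[symmetric]
  by (rule uea_proj_eqI) (auto simp: uea_relations_def)

lemma uea_gen_scale:
  "uea_gen scale bracket (scale c x) = uea_scale scale bracket c (uea_gen scale bracket x)"
  unfolding uea_gen_def uea_scale_def uea_proj_mult[symmetric]
  by (rule uea_proj_eqI) (auto simp: uea_relations_def)

text \<open>This is the third family of relations, arranged as a rule for moving one generator past
  another. \<open>diff_diff_eq\<close> gathers the two subtracted terms of the relation into one
  sum.\<close>

lemma uea_gen_commute:
  "uea_gen scale bracket x \<otimes>\<^bsub>uea scale bracket\<^esub> uea_gen scale bracket y
     = uea_gen scale bracket y \<otimes>\<^bsub>uea scale bracket\<^esub> uea_gen scale bracket x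
         \<oplus>\<^bsub>uea scale bracket\<^esub> uea_gen scale bracket (bracket x y)"
  unfolding uea_gen_def uea_proj_mult[symmetric] uea_proj_add[symmetric]
  by (rule uea_proj_eqI) (force simp: uea_relations_def diff_diff_eq)

lemma uea_scale_closed:
  "u \<in> carrier (uea scale bracket) \<Longrightarrow> uea_scale scale bracket c u \<in> carrier (uea scale bracket)"
  unfolding uea_scale_def
  by (intro ring.ring_simprules(5)[OF ring_uea] uea_proj_closed)

text \<open>Scaling is left multiplication by the class of a constant, so this is
  associativity.\<close>

lemma uea_scale_mult_left:
  assumes "u \<in> carrier (uea scale bracket)" "v \<in> carrier (uea scale bracket)"
  shows "uea_scale scale bracket c u \<otimes>\<^bsub>uea scale bracket\<^esub> v
           = uea_scale scale bracket c (u \<otimes>\<^bsub>uea scale bracket\<^esub> v)"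
  unfolding uea_scale_def
  using assms by (simp add: ring.ring_simprules(11)[OF ring_uea] uea_proj_closed)

lemma uea_scale_finsum:
  assumes "finite I" "f \<in> I \<rightarrow> carrier (uea scale bracket)"
  shows "uea_scale scale bracket c (finsum (uea scale bracket) f I)
           = (\<Oplus>\<^bsub>uea scale bracket\<^esub>i\<in>I. uea_scale scale bracket c (f i))"
proof -
  interpret U: ring "uea scale bracket" by (rule ring_uea)
  show ?thesis
    unfolding uea_scale_def using assms by (intro U.finsum_rdistr uea_proj_closed)
qed

text \<open>The first two families of relations make \<open>uea_gen\<close> linear. This carries the
  expansion of a bracket in structure constants over to the enveloping algebra.\<close>

lemma uea_gen_sum_scale:
  assumes "finite I"
  shows "uea_gen scale bracket (\<Sum>i\<in>I. scale (c i) (x i))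
           = (\<Oplus>\<^bsub>uea scale bracket\<^esub>i\<in>I. uea_scale scale bracket (c i) (uea_gen scale bracket (x i)))"
proof -
  interpret U: ring "uea scale bracket" by (rule ring_uea)
  have "uea_gen scale bracket 0 \<oplus>\<^bsub>uea scale bracket\<^esub> uea_gen scale bracket 0
          = uea_gen scale bracket 0"
    by (simp flip: uea_gen_add)
  then have zero: "uea_gen scale bracket 0 = \<zero>\<^bsub>uea scale bracket\<^esub>"
    by (simp add: uea_gen_closed)
  show ?thesis
    using assms
    by induction (simp_all add: zero uea_gen_add uea_gen_scale uea_gen_closed uea_scale_closed Pi_def)
qed

lemma uea_monomial_closed: "uea_monomial scale bracket xs \<in> carrier (uea scale bracket)"
proof -
  interpret U: ring "uea scale bracket" by (rule ring_uea)
  show ?thesis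
    by (induction xs) (simp_all add: uea_monomial_def uea_gen_closed)
qed

context left_action
begin

abbreviation "U \<equiv> uea scale bracket"
abbreviation "UL \<equiv> uea scaleL bracketL"
abbreviation "x\<^sub>U \<mu> \<equiv> uea_gen scale bracket (X \<mu>)"
abbreviation "t\<^sub>U \<mu> \<nu> \<equiv> uea_gen scaleL bracketL (T \<mu> \<nu>)"

text \<open>Since generators coming from the smaller Lie algebra act by left multiplication, the
  left side is the action of a product in \<open>UL\<close> on \<open>w\<close>. Commuting the two
  factors there produces a bracket that is a combination of the \<open>T \<alpha> \<nu>\<close> with
  the same second index \<open>\<nu>\<close>.\<close>

lemma act_T_X_mult:
  assumes \<mu>: "\<mu> \<in> {1..n}" and \<nu>: "\<nu> \<in> {1..n}" and \<kappa>: "\<kappa> \<in> {1..n}" and w: "w \<in> carrier U"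
  shows "act (t\<^sub>U \<mu> \<nu>) (x\<^sub>U \<kappa> \<otimes>\<^bsub>U\<^esub> w)
           = x\<^sub>U \<kappa> \<otimes>\<^bsub>U\<^esub> act (t\<^sub>U \<mu> \<nu>) w
               \<oplus>\<^bsub>U\<^esub> (\<Oplus>\<^bsub>U\<^esub>\<alpha>\<in>{1..n}. uea_scale scale bracket (C \<mu> \<kappa> \<alpha>) (act (t\<^sub>U \<alpha> \<nu>) w))"
proof -
  interpret U: ring U by (rule ring_uea)
  interpret UL: ring UL by (rule ring_uea)
  \<comment> \<open>\<open>?x\<close> is the copy in \<open>UL\<close> of
    \<open>x\<^sub>U \<kappa>\<close>, which lives in \<open>U\<close>; \<open>act_X\<close> links
    the two.\<close>
  let ?x = "uea_gen scaleL bracketL (emb (X \<kappa>))"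
  let ?D = "uea_gen scaleL bracketL (bracketL (T \<mu> \<nu>) (emb (X \<kappa>)))"
  have D: "?D = (\<Oplus>\<^bsub>UL\<^esub>\<alpha>\<in>{1..n}. uea_scale scaleL bracketL (C \<mu> \<kappa> \<alpha>) (t\<^sub>U \<alpha> \<nu>))"
    unfolding bracket_T_X[OF \<mu> \<nu> \<kappa>] by (rule uea_gen_sum_scale) simp
  have "act ?D w = (\<Oplus>\<^bsub>U\<^esub>\<alpha>\<in>{1..n}. act (uea_scale scaleL bracketL (C \<mu> \<kappa> \<alpha>) (t\<^sub>U \<alpha> \<nu>)) w)"
    unfolding D
    by (rule additive_finsum[where f = "\<lambda>a. act a w"])
      (auto simp: U.abelian_group_axioms UL.abelian_group_axioms w act_closed act_add_left
        uea_gen_closed uea_scale_closed)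
  also have "\<dots> = (\<Oplus>\<^bsub>U\<^esub>\<alpha>\<in>{1..n}. uea_scale scale bracket (C \<mu> \<kappa> \<alpha>) (act (t\<^sub>U \<alpha> \<nu>) w))"
    by (intro U.finsum_cong') (auto simp: w act_scale_left uea_gen_closed uea_scale_closed act_closed)
  finally have actD: "act ?D w = \<dots>" .
  have "act (t\<^sub>U \<mu> \<nu>) (x\<^sub>U \<kappa> \<otimes>\<^bsub>U\<^esub> w) = act (t\<^sub>U \<mu> \<nu> \<otimes>\<^bsub>UL\<^esub> ?x) w"
    using \<kappa> w by (simp add: act_mult act_X uea_gen_closed)
  also have "\<dots> = act (?x \<otimes>\<^bsub>UL\<^esub> t\<^sub>U \<mu> \<nu> \<oplus>\<^bsub>UL\<^esub> ?D) w"
    by (simp only: uea_gen_commute[of _ _ "T \<mu> \<nu>"])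
  also have "\<dots> = x\<^sub>U \<kappa> \<otimes>\<^bsub>U\<^esub> act (t\<^sub>U \<mu> \<nu>) w \<oplus>\<^bsub>U\<^esub> act ?D w"
    using \<kappa> w by (simp add: act_add_left act_mult act_X act_closed uea_gen_closed)
  finally show ?thesis
    unfolding actD .
qed

text \<open>The induction keeps \<open>\<mu>\<close> arbitrary because the bracket of
  \<open>X \<mu>\<close> with the first letter may involve every basis element
  \<open>X \<beta>\<close>.\<close>

lemma X_mult_monomial:
  assumes "set ks \<subseteq> {1..n}" "\<mu> \<in> {1..n}"
  shows "x\<^sub>U \<mu> \<otimes>\<^bsub>U\<^esub> uea_monomial scale bracket (map X ks)
    = (\<Oplus>\<^bsub>U\<^esub>\<alpha>\<in>{1..n}. act (t\<^sub>U \<mu> \<alpha>) (uea_monomial scale bracket (map X ks)) \<otimes>\<^bsub>U\<^esub> x\<^sub>U \<alpha>)"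
  using assms
proof (induction ks arbitrary: \<mu>)
  case Nil
  interpret U: ring U by (rule ring_uea)
  \<comment> \<open>On the empty monomial the action is the Kronecker delta, so only the summand at
    \<open>\<mu>\<close> survives.\<close>
  have "(\<Oplus>\<^bsub>U\<^esub>\<alpha>\<in>{1..n}. act (t\<^sub>U \<mu> \<alpha>) \<one>\<^bsub>U\<^esub> \<otimes>\<^bsub>U\<^esub> x\<^sub>U \<alpha>)
      = (\<Oplus>\<^bsub>U\<^esub>\<alpha>\<in>{1..n}. if \<mu> = \<alpha> then x\<^sub>U \<alpha> else \<zero>\<^bsub>U\<^esub>)"
    using Nil by (intro U.finsum_cong') (auto simp: act_T_one uea_gen_closed)
  also have "\<dots> = x\<^sub>U \<mu>"
    using Nil by (intro U.finsum_singleton) (auto simp: uea_gen_closed)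
  finally show ?case
    by (simp add: uea_monomial_def uea_gen_closed)
next
  case (Cons \<kappa> ks)
  interpret U: ring U by (rule ring_uea)
  define w where "w = uea_monomial scale bracket (map X ks)"
  have w: "w \<in> carrier U"
    unfolding w_def by (rule uea_monomial_closed)
  have \<kappa>: "\<kappa> \<in> {1..n}" and \<mu>: "\<mu> \<in> {1..n}"
    using Cons.prems by auto
  have IH: "x\<^sub>U \<beta> \<otimes>\<^bsub>U\<^esub> w = (\<Oplus>\<^bsub>U\<^esub>\<alpha>\<in>{1..n}. act (t\<^sub>U \<beta> \<alpha>) w \<otimes>\<^bsub>U\<^esub> x\<^sub>U \<alpha>)" if "\<beta> \<in> {1..n}" for \<beta>
    unfolding w_def using Cons that by simp
  let ?c = "\<lambda>\<beta>. uea_scale scale bracket (C \<mu> \<kappa> \<beta>)"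
  note closed = w act_closed uea_gen_closed uea_scale_closed
  \<comment> \<open>The induction hypothesis at \<open>\<mu>\<close>, multiplied by
    \<open>x\<^sub>U \<kappa>\<close> from the left.\<close>
  have left: "x\<^sub>U \<kappa> \<otimes>\<^bsub>U\<^esub> (x\<^sub>U \<mu> \<otimes>\<^bsub>U\<^esub> w)
      = (\<Oplus>\<^bsub>U\<^esub>\<alpha>\<in>{1..n}. x\<^sub>U \<kappa> \<otimes>\<^bsub>U\<^esub> act (t\<^sub>U \<mu> \<alpha>) w \<otimes>\<^bsub>U\<^esub> x\<^sub>U \<alpha>)"
    using \<mu> by (simp add: IH U.finsum_rdistr U.m_assoc closed Pi_def)
  \<comment> \<open>The bracket term uses the induction hypothesis at every \<open>\<beta>\<close>.
    Exchanging the sums then makes \<open>\<alpha>\<close> the outer index, as in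
    \<open>left\<close>.\<close>
  have "uea_gen scale bracket (bracket (X \<mu>) (X \<kappa>)) \<otimes>\<^bsub>U\<^esub> w
      = (\<Oplus>\<^bsub>U\<^esub>\<beta>\<in>{1..n}. ?c \<beta> (x\<^sub>U \<beta>) \<otimes>\<^bsub>U\<^esub> w)"
    using \<mu> \<kappa>
    by (simp add: g.structure_constants uea_gen_sum_scale U.finsum_ldistr closed Pi_def)
  also have "\<dots> = (\<Oplus>\<^bsub>U\<^esub>\<beta>\<in>{1..n}. \<Oplus>\<^bsub>U\<^esub>\<alpha>\<in>{1..n}. ?c \<beta> (act (t\<^sub>U \<beta> \<alpha>) w) \<otimes>\<^bsub>U\<^esub> x\<^sub>U \<alpha>)"
    by (intro U.finsum_cong')
      (auto simp: uea_scale_mult_left IH uea_scale_finsum closed Pi_def)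
  also have "\<dots> = (\<Oplus>\<^bsub>U\<^esub>\<alpha>\<in>{1..n}. \<Oplus>\<^bsub>U\<^esub>\<beta>\<in>{1..n}. ?c \<beta> (act (t\<^sub>U \<beta> \<alpha>) w) \<otimes>\<^bsub>U\<^esub> x\<^sub>U \<alpha>)"
    by (intro U.finsum_swap) (auto simp: closed)
  also have "\<dots> = (\<Oplus>\<^bsub>U\<^esub>\<alpha>\<in>{1..n}. (\<Oplus>\<^bsub>U\<^esub>\<beta>\<in>{1..n}. ?c \<beta> (act (t\<^sub>U \<beta> \<alpha>) w)) \<otimes>\<^bsub>U\<^esub> x\<^sub>U \<alpha>)"
    by (intro U.finsum_cong') (auto simp: U.finsum_ldistr closed Pi_def)
  finally have right: "uea_gen scale bracket (bracket (X \<mu>) (X \<kappa>)) \<otimes>\<^bsub>U\<^esub> w = \<dots>" .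
  have "x\<^sub>U \<mu> \<otimes>\<^bsub>U\<^esub> (x\<^sub>U \<kappa> \<otimes>\<^bsub>U\<^esub> w) = (x\<^sub>U \<mu> \<otimes>\<^bsub>U\<^esub> x\<^sub>U \<kappa>) \<otimes>\<^bsub>U\<^esub> w"
    by (simp add: U.m_assoc closed)
  also have "\<dots> = x\<^sub>U \<kappa> \<otimes>\<^bsub>U\<^esub> (x\<^sub>U \<mu> \<otimes>\<^bsub>U\<^esub> w)
      \<oplus>\<^bsub>U\<^esub> uea_gen scale bracket (bracket (X \<mu>) (X \<kappa>)) \<otimes>\<^bsub>U\<^esub> w"
    by (simp add: uea_gen_commute[of _ _ "X \<mu>"] U.m_assoc U.l_distr closed)
  also have "\<dots> = (\<Oplus>\<^bsub>U\<^esub>\<alpha>\<in>{1..n}. act (t\<^sub>U \<mu> \<alpha>) (x\<^sub>U \<kappa> \<otimes>\<^bsub>U\<^esub> w) \<otimes>\<^bsub>U\<^esub> x\<^sub>U \<alpha>)"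
  proof -
    \<comment> \<open>The target is expanded instead: \<open>act_T_X_mult\<close> splits each
      summand in two, and the two resulting sums are those of \<open>left\<close> and
      \<open>right\<close>.\<close>
    have "(\<Oplus>\<^bsub>U\<^esub>\<alpha>\<in>{1..n}. act (t\<^sub>U \<mu> \<alpha>) (x\<^sub>U \<kappa> \<otimes>\<^bsub>U\<^esub> w) \<otimes>\<^bsub>U\<^esub> x\<^sub>U \<alpha>)
        = (\<Oplus>\<^bsub>U\<^esub>\<alpha>\<in>{1..n}. x\<^sub>U \<kappa> \<otimes>\<^bsub>U\<^esub> act (t\<^sub>U \<mu> \<alpha>) w \<otimes>\<^bsub>U\<^esub> x\<^sub>U \<alpha>
            \<oplus>\<^bsub>U\<^esub> (\<Oplus>\<^bsub>U\<^esub>\<beta>\<in>{1..n}. ?c \<beta> (act (t\<^sub>U \<beta> \<alpha>) w)) \<otimes>\<^bsub>U\<^esub> x\<^sub>U \<alpha>)"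
      using \<mu> \<kappa> by (intro U.finsum_cong') (simp_all add: act_T_X_mult U.l_distr closed Pi_def)
    then show ?thesis
      unfolding left right by (simp add: closed Pi_def)
  qed
  finally show ?case
    by (simp add: w_def uea_monomial_def)
qed

end

(* Up to isomorphism, the instances of real_normed_field are exactly the reals and the complex
   numbers. *)
theorem lemma1:
  fixes scale :: "'k::real_normed_field \<Rightarrow> 'a::ab_group_add \<Rightarrow> 'a"
    and bracket :: "'a \<Rightarrow> 'a \<Rightarrow> 'a"
    and n :: nat and X :: "nat \<Rightarrow> 'a" and C :: "nat \<Rightarrow> nat \<Rightarrow> nat \<Rightarrow> 'k"
    and scaleL :: "'k \<Rightarrow> 'b::ab_group_add \<Rightarrow> 'b"
    and bracketL :: "'b \<Rightarrow> 'b \<Rightarrow> 'b"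
    and emb :: "'a \<Rightarrow> 'b" and T :: "nat \<Rightarrow> nat \<Rightarrow> 'b"
    and act :: "('b free_monoid \<Rightarrow>\<^sub>0 'k) set \<Rightarrow> ('a free_monoid \<Rightarrow>\<^sub>0 'k) set \<Rightarrow> ('a free_monoid \<Rightarrow>\<^sub>0 'k) set"
    and ks :: "nat list" and \<mu> :: nat
  assumes "based_lie_algebra scale bracket n X C"
    and "extended_lie_algebra scale bracket n X C scaleL bracketL emb T"
    and "left_action scale bracket n X C scaleL bracketL emb T act"
    and "set ks \<subseteq> {1..n}"
    and "\<mu> \<in> {1..n}"
  shows "uea_gen scale bracket (X \<mu>) \<otimes>\<^bsub>uea scale bracket\<^esub> uea_monomial scale bracket (map X ks)
    = (\<Oplus>\<^bsub>uea scale bracket\<^esub>\<alpha>\<in>{1..n}.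
        act (uea_gen scaleL bracketL (T \<mu> \<alpha>)) (uea_monomial scale bracket (map X ks))
          \<otimes>\<^bsub>uea scale bracket\<^esub> uea_gen scale bracket (X \<alpha>))"
  by (rule left_action.X_mult_monomial[OF assms(3-5)])

end
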